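(* Let $n\in\mathbb{N}$ with $n>1$, let $f(z)=\sum_{k=0}^{n}t_k z^{n-k}\in\mathbb{C}[z]$ be a degree-$n$ polynomial with $t_0=1$, and let $\lambda_{n+1}\in\mathbb{C}$. Then there exists a polynomial $$f_{\lambda_{n+1}}(z)=\sum_{k=0}^{n+1}s_k z^{(n+1)-k}\in\mathbb{C}[z]$$ whose zeroes are the zeroes of $f(z)$ and $\lambda_{n+1}$ in $\mathbb{C}$. In particular, its coefficients are given by $s_0=1$, $s_k=t_k-t_{k-1}\lambda_{n+1}$ for all $k=1,\dots,n$, and $s_{n+1}=-t_n\lambda_{n+1}$. *)

theory Defs
  imports "HOL-Computational_Algebra.Polynomial"
begin

end

theory Submission
  imports Defs
begin

text \<open>The witness is the product of \<open>f\<close> and the linear factor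
  \<open>[:- lam, 1:]\<close>: a product vanishes exactly where a factor does, and over nonzero
  polynomials \<open>proots\<close> turns products into multiset sums. The coefficients come from
  \<open>sum_monom_mult_linear\<close>: multiplying by the variable keeps the index \<open>k\<close>
  counted from the leading term, multiplying by the constant moves it to \<open>k + 1\<close>, and
  the two sums are subtracted termwise.\<close>

lemma sum_monom_mult_linear:
  fixes t :: "nat \<Rightarrow> 'a :: comm_ring_1"
  shows "(\<Sum>k=0..n. monom (t k) (n - k)) * [:- c, 1:] =
    (\<Sum>k=0..n+1. monom ((if k \<le> n then t k else 0) - (if k = 0 then 0 else t (k - 1) * c)) (n + 1 - k))"
proof -
  \<comment> \<open>Padding with 0 at \<open>k = n + 1\<close> gives both parts the common range
    \<open>0..n+1\<close>.\<close>
  have X: "(\<Sum>k=0..n+1. monom (if k \<le> n then t k else 0) (n + 1 - k)) =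
    (\<Sum>k=0..n. monom (t k) (n - k)) * monom 1 1"
    by (simp add: sum_distrib_right mult_monom Suc_diff_le)
  have C: "(\<Sum>k=0..n+1. monom (if k = 0 then 0 else t (k - 1) * c) (n + 1 - k)) =
    (\<Sum>k=0..n. monom (t k) (n - k)) * monom c 0"
    \<comment> \<open>Here the padding sits at \<open>k = 0\<close>, so that term is split off and
      the rest reindexed by \<open>Suc\<close>.\<close>
    unfolding Suc_eq_plus1[symmetric] sum.atLeast0_atMost_Suc_shift
    by (simp add: sum_distrib_right mult_monom)
  have L: "[:- c, 1:] = monom 1 1 - monom c 0"
    by (simp add: monom_altdef monom_0)
  show ?thesis
    unfolding diff_monom[symmetric] sum_subtractf X C L
    by (simp add: right_diff_distrib)
qed

theorem proposition4p1:
  fixes n :: nat and t :: "nat \<Rightarrow> complex" and f :: "complex poly" and lam :: complex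
  assumes "n > 1"
    and "f = (\<Sum>k=0..n. monom (t k) (n - k))"
    and "degree f = n"
    and "t 0 = 1"
  shows "\<exists>(g :: complex poly) (s :: nat \<Rightarrow> complex).
           g = (\<Sum>k=0..n+1. monom (s k) ((n + 1) - k)) \<and>
           {z. poly g z = 0} = {z. poly f z = 0} \<union> {lam} \<and>
           proots g = proots f + {#lam#} \<and>
           s 0 = 1 \<and>
           (\<forall>k\<in>{1..n}. s k = t k - t (k - 1) * lam) \<and>
           s (n + 1) = - t n * lam"
proof -
  define g where "g = f * [:- lam, 1:]"
  \<comment> \<open>The two conditionals act as \<open>t (n + 1) = 0\<close> and
    \<open>t (-1) = 0\<close>, so one formula covers both end coefficients.\<close>
  define s where "s = (\<lambda>k. (if k \<le> n then t k else 0) - (if k = 0 then 0 else t (k - 1) * lam))"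
  have "g = (\<Sum>k=0..n+1. monom (s k) ((n + 1) - k))"
    unfolding g_def s_def assms(2) by (rule sum_monom_mult_linear)
  moreover have "{z. poly g z = 0} = {z. poly f z = 0} \<union> {lam}"
    by (auto simp: g_def)
  \<comment> \<open>The zero polynomial has degree 0. \<open>proots_mult\<close> requires nonzero
    factors.\<close>
  moreover have "f \<noteq> 0"
    using assms(1,3) by auto
  then have "proots g = proots f + {#lam#}"
    unfolding g_def by (subst proots_mult) auto
  moreover have "s 0 = 1" "\<forall>k\<in>{1..n}. s k = t k - t (k - 1) * lam" "s (n + 1) = - t n * lam"
    using assms(4) by (auto simp: s_def)
  ultimately show ?thesis
    by blast
qed

end
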